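(* Let $d\ge2$, $D=\{1,\dots,d\}$. Suppose that an absolutely continuous $d$-variate random vector $\boldsymbol{X}=(X_1,\dots,X_d)^\top$ with univariate marginal distribution functions $F_1,\dots,F_d$ and unique copula density $c$ satisfies the following: $\boldsymbol X$ has a support of the form $\Omega=\Omega_1\times\cdots\times\Omega_d$ and is absolutely continuous with respect to Lebesgue measure; for every $i\in D$, the marginal density $f_i$ of $X_i$ is strictly positive on $\Omega_i$; and the unique copula $C$ of $\boldsymbol X$ has a Lebesgue density $c$ such that $\ln(c)$ is defined almost everywhere and square-integrable on $[0,1]^d$. Then the map $c\circ\boldsymbol F$, defined for all $(x_1,\dots,x_d)\in\Omega$ by $(c\circ\boldsymbol F)(x_1,\dots,x_d)=c\{F_1(x_1),\dots,F_d(x_d)\}$, can be decomposed, in the Bayes space $\mathcal{B}^2(\pi_\perp)$ on $\Omega$, as \[ c\circ\boldsymbol F=c_{\mathrm{ind}}\circ\boldsymbol F\ \oplus\bigoplus_{I\subseteq D,\ |I|\ge2}c_{I,\mathrm{int}}\circ\boldsymbol F . \]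
   Context: Bayes space. For a finite, positive, nonzero measure $\lambda$ on a measurable space $(\Omega,\mathcal{A})$, $\mathcal{M}(\lambda)$ is the set of $\sigma$-finite positive measures $\mu$ on $(\Omega,\mathcal A)$ with the same null sets as $\lambda$; $\mu$ is identified with its $\lambda$-density $f_\mu=d\mu/d\lambda$. Write $f_\mu\propto f_\nu$ if $f_\mu=k f_\nu$ ($\lambda$-a.e.) for some $k\in(0,\infty)$. The Bayes space is $\mathcal{B}(\lambda)=\mathcal{M}(\lambda)/\!\propto$; equality of elements means $\propto$. Vector space operations: $f\oplus g\propto fg$, $\alpha\odot f\propto f^{\alpha}$. $\mathcal{B}^2(\lambda)=\{f\in\mathcal{B}(\lambda):\int_\Omega|\ln f|^2d\lambda<\infty\}$. Copula. The copula $C:[0,1]^d\to[0,1]$ of $\boldsymbol X$ is the distribution function with standard uniform univariate margins such that $\Pr(X_1\le x_1,\dots,X_d\le x_d)=C\{F_1(x_1),\dots,F_d(x_d)\}$ for all $x_1,\dots,x_d\in\mathbb R$. $\pi_{X_i}$ is the law of $X_i$ and $\pi_\perp=\pi_{X_1}\otimes\cdots\otimes\pi_{X_d}$; $c\circ\boldsymbol F$ is the density with respect to $\pi_\perp$ of the law of $\boldsymbol X$. $\boldsymbol F=(F_1,\dots,F_d)$ and, for a function $g$ on $[0,1]^d$, $(g\circ\boldsymbol F)(x_1,\dots,x_d)=g\{F_1(x_1),\dots,F_d(x_d)\}$. Parts of $c$. View $c$ as an element of $\mathcal{B}^2(\lambda)$ on $[0,1]^d$ with $\lambda$ the Lebesgue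 measure. For non-empty $I\subsetneq D$ its $I$-th geometric margin is $c_I\propto\exp\{\int_{[0,1]^{D\setminus I}}\ln(c)\,d\lambda_{D\setminus I}\}$ (integration over the coordinates not in $I$, with respect to Lebesgue measure), $c_D=c$, $c_i=c_{\{i\}}$. The independence and interaction parts of $c$ are $c_{\mathrm{ind}}=\bigoplus_{i=1}^d c_i$ and, for $|I|\ge2$, $c_{I,\mathrm{int}}=\bigoplus_{J\subseteq I,\,J\ne\varnothing}\{(-1)^{|I\setminus J|}\}\odot c_J$. *)

theory Defs
  imports "HOL-Probability.Probability" "HOL-Algebra.Module"
begin

section \<open>Bayes spaces\<close>

definition bayes_measures :: "'a measure \<Rightarrow> 'a measure set" where
  "bayes_measures L =
     {\<mu>. sigma_finite_measure \<mu> \<and> sets \<mu> = sets L \<and> null_sets \<mu> = null_sets L}"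

text \<open>A measure in \<^const>\<open>bayes_measures\<close> is represented by its density with respect to \<open>L\<close>.
  Sigma-finiteness makes that density finite almost everywhere, so it can be taken real-valued.
  Values outside \<open>space L\<close>, and on null sets, are irrelevant.\<close>

definition bayes_densities :: "'a measure \<Rightarrow> ('a \<Rightarrow> real) set" where
  "bayes_densities L =
     {f \<in> borel_measurable L. density L (\<lambda>x. ennreal (f x)) \<in> bayes_measures L}"

definition bayes_rel :: "'a measure \<Rightarrow> (('a \<Rightarrow> real) \<times> ('a \<Rightarrow> real)) set" where
  "bayes_rel L =
     {(f, g). f \<in> bayes_densities L \<and> g \<in> bayes_densities L \<and>
              (\<exists>k>0. AE x in L. f x = k * g x)}"

definition bayes_space :: "'a measure \<Rightarrow> ('a \<Rightarrow> real) set set" where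
  "bayes_space L = bayes_densities L // bayes_rel L"

text \<open>The class of \<open>f\<close> is empty, hence not a member of \<^const>\<open>bayes_space\<close>, if \<open>f\<close> is not the
  density of an admissible measure.\<close>

definition bayes_class :: "'a measure \<Rightarrow> ('a \<Rightarrow> real) \<Rightarrow> ('a \<Rightarrow> real) set" where
  "bayes_class L f = bayes_rel L `` {f}"

definition bayes_add ::
  "'a measure \<Rightarrow> ('a \<Rightarrow> real) set \<Rightarrow> ('a \<Rightarrow> real) set \<Rightarrow> ('a \<Rightarrow> real) set" where
  "bayes_add L A B = (\<Union>f\<in>A. \<Union>g\<in>B. bayes_class L (\<lambda>x. f x * g x))"

definition bayes_smult :: "'a measure \<Rightarrow> real \<Rightarrow> ('a \<Rightarrow> real) set \<Rightarrow> ('a \<Rightarrow> real) set" where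
  "bayes_smult L \<alpha> A = (\<Union>f\<in>A. bayes_class L (\<lambda>x. f x powr \<alpha>))"

definition bayes2_space :: "'a measure \<Rightarrow> ('a \<Rightarrow> real) set set" where
  "bayes2_space L = {A \<in> bayes_space L. \<forall>f\<in>A. integrable L (\<lambda>x. \<bar>ln (f x)\<bar>\<^sup>2)}"

text \<open>The vector space \<open>B\<^sup>2(L)\<close>, packaged as a module record so that \<open>\<oplus>\<close>, \<open>\<Oplus>\<close> and \<open>\<odot>\<close> are
  available; the ring multiplication fields of the record play no role.\<close>

definition bayes2 :: "'a measure \<Rightarrow> (real, ('a \<Rightarrow> real) set) module" where
  "bayes2 L =
     \<lparr>carrier = bayes2_space L, mult = undefined, one = undefined,
      zero = bayes_class L (\<lambda>_. 1), add = bayes_add L, smult = bayes_smult L\<rparr>"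

text \<open>Composition \<open>A \<circ> T\<close> of a class \<open>A\<close> with a map \<open>T\<close>, as a class over the measure \<open>P\<close>.\<close>

definition bayes_comp ::
  "'b measure \<Rightarrow> ('a \<Rightarrow> real) set \<Rightarrow> ('b \<Rightarrow> 'a) \<Rightarrow> ('b \<Rightarrow> real) set" where
  "bayes_comp P A T = (\<Union>g\<in>A. bayes_class P (\<lambda>x. g (T x)))"

lemma bayes_densities_iff:
  assumes "sigma_finite_measure L"
  shows "f \<in> bayes_densities L \<longleftrightarrow> f \<in> borel_measurable L \<and> (AE x in L. 0 < f x)"
proof (cases "f \<in> borel_measurable L")
  case [measurable]: True
  interpret sigma_finite_measure L by fact
  let ?N = "density L (\<lambda>x. ennreal (f x))"
  have sf: "sigma_finite_measure ?N"
    by (subst sigma_finite_iff_density_finite) auto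
  have "null_sets ?N = null_sets L \<longleftrightarrow> (AE x in L. 0 < f x)"
  proof
    assume eq: "null_sets ?N = null_sets L"
    let ?Z = "{x \<in> space L. f x \<le> 0}"
    have "?Z \<in> null_sets ?N"
      by (subst null_sets_density_iff) (auto simp: ennreal_neg)
    with eq have "?Z \<in> null_sets L" by simp
    then show "AE x in L. 0 < f x"
      by (rule AE_I') auto
  next
    assume pos: "AE x in L. 0 < f x"
    show "null_sets ?N = null_sets L"
    proof (intro Set.set_eqI iffI)
      fix A assume "A \<in> null_sets ?N"
      then have A: "A \<in> sets L" "AE x in L. x \<in> A \<longrightarrow> ennreal (f x) = 0"
        by (auto simp: null_sets_density_iff)
      have "AE x in L. x \<notin> A"
        using A(2) pos by eventually_elim auto
      with A(1) show "A \<in> null_sets L" by (simp add: AE_iff_null_sets)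
    next
      fix A assume "A \<in> null_sets L"
      then show "A \<in> null_sets ?N"
        by (subst null_sets_density_iff) (auto dest: AE_not_in)
    qed
  qed
  with sf show ?thesis by (simp add: bayes_densities_def bayes_measures_def)
qed (simp add: bayes_densities_def)

lemma equiv_bayes_rel: "equiv (bayes_densities L) (bayes_rel L)"
proof (rule equivI)
  show "bayes_rel L \<subseteq> bayes_densities L \<times> bayes_densities L"
    by (auto simp: bayes_rel_def)
  show "refl_on (bayes_densities L) (bayes_rel L)"
    by (auto simp: refl_on_def bayes_rel_def intro!: exI[of _ 1])
  show "sym (bayes_rel L)"
  proof (rule symI)
    fix f g assume "(f, g) \<in> bayes_rel L"
    then obtain k :: real where k: "k > 0" "AE x in L. f x = k * g x"
      and "f \<in> bayes_densities L" "g \<in> bayes_densities L"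
      by (auto simp: bayes_rel_def)
    moreover have "AE x in L. g x = (1 / k) * f x"
      using k(2) by eventually_elim (use k(1) in auto)
    moreover have "1 / k > 0" using k(1) by simp
    ultimately show "(g, f) \<in> bayes_rel L" unfolding bayes_rel_def by blast
  qed
  show "trans (bayes_rel L)"
  proof (rule transI)
    fix f g h assume "(f, g) \<in> bayes_rel L" "(g, h) \<in> bayes_rel L"
    then obtain k l :: real where kl: "k > 0" "l > 0"
        "AE x in L. f x = k * g x" "AE x in L. g x = l * h x"
      and "f \<in> bayes_densities L" "h \<in> bayes_densities L"
      by (auto simp: bayes_rel_def)
    moreover have "AE x in L. f x = (k * l) * h x"
      using kl(3,4) by eventually_elim auto
    moreover have "k * l > 0" using kl by simp
    ultimately show "(f, h) \<in> bayes_rel L" unfolding bayes_rel_def by blast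
  qed
qed

lemma bayes_class_in_space: "f \<in> bayes_densities L \<Longrightarrow> bayes_class L f \<in> bayes_space L"
  by (auto simp: bayes_class_def bayes_space_def intro: quotientI)

lemma bayes_class_eq_iff:
  assumes "f \<in> bayes_densities L" "g \<in> bayes_densities L"
  shows "bayes_class L f = bayes_class L g \<longleftrightarrow> (\<exists>k>0. AE x in L. f x = k * g x)"
  using eq_equiv_class_iff[OF equiv_bayes_rel assms] assms
  by (simp add: bayes_class_def bayes_rel_def)

lemma bayes_class_self: "f \<in> bayes_densities L \<Longrightarrow> f \<in> bayes_class L f"
  by (auto simp: bayes_class_def bayes_rel_def intro!: exI[of _ 1])

lemma bayes_add_class:
  assumes L: "sigma_finite_measure L"
    and f: "f \<in> bayes_densities L" and g: "g \<in> bayes_densities L"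
  shows "bayes_add L (bayes_class L f) (bayes_class L g) = bayes_class L (\<lambda>x. f x * g x)"
proof -
  have prod: "(\<lambda>x. u x * v x) \<in> bayes_densities L"
    if "u \<in> bayes_densities L" "v \<in> bayes_densities L" for u v
    using that by (auto simp: bayes_densities_iff[OF L])
  have "bayes_class L (\<lambda>x. u x * v x) = bayes_class L (\<lambda>x. f x * g x)"
    if uv: "u \<in> bayes_class L f" "v \<in> bayes_class L g" for u v
  proof -
    obtain k l :: real where kl: "k > 0" "l > 0"
        "AE x in L. f x = k * u x" "AE x in L. g x = l * v x"
      and D: "u \<in> bayes_densities L" "v \<in> bayes_densities L"
      using uv by (auto simp: bayes_class_def bayes_rel_def)
    have "AE x in L. f x * g x = (k * l) * (u x * v x)"
      using kl(3,4) by eventually_elim simp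
    moreover have "k * l > 0" using kl by simp
    ultimately have "bayes_class L (\<lambda>x. f x * g x) = bayes_class L (\<lambda>x. u x * v x)"
      using prod D f g by (subst bayes_class_eq_iff) blast+
    then show ?thesis by simp
  qed
  then show ?thesis
    using bayes_class_self[OF f] bayes_class_self[OF g] unfolding bayes_add_def by blast
qed

lemma bayes_smult_class:
  assumes L: "sigma_finite_measure L" and f: "f \<in> bayes_densities L"
  shows "bayes_smult L \<alpha> (bayes_class L f) = bayes_class L (\<lambda>x. f x powr \<alpha>)"
proof -
  have pow: "(\<lambda>x. u x powr \<alpha>) \<in> bayes_densities L" if "u \<in> bayes_densities L" for u
    using that by (auto simp: bayes_densities_iff[OF L])
  have "bayes_class L (\<lambda>x. u x powr \<alpha>) = bayes_class L (\<lambda>x. f x powr \<alpha>)"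
    if u: "u \<in> bayes_class L f" for u
  proof -
    obtain k :: real where k: "k > 0" "AE x in L. f x = k * u x"
      and D: "u \<in> bayes_densities L"
      using u by (auto simp: bayes_class_def bayes_rel_def)
    have "AE x in L. 0 < u x" using D by (simp add: bayes_densities_iff[OF L])
    with k(2) have "AE x in L. f x powr \<alpha> = k powr \<alpha> * u x powr \<alpha>"
      by eventually_elim (use k(1) in \<open>simp add: powr_mult\<close>)
    moreover have "k powr \<alpha> > 0" using k by simp
    ultimately have "bayes_class L (\<lambda>x. f x powr \<alpha>) = bayes_class L (\<lambda>x. u x powr \<alpha>)"
      using pow D f by (subst bayes_class_eq_iff) blast+
    then show ?thesis by simp
  qed
  then show ?thesis
    using bayes_class_self[OF f] unfolding bayes_smult_def by blast
qed

lemma bayes2_classE: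
  assumes "A \<in> bayes2_space L"
  obtains f where "A = bayes_class L f" "f \<in> bayes_densities L"
    "integrable L (\<lambda>x. \<bar>ln (f x)\<bar>\<^sup>2)"
proof -
  from assms obtain f where f: "A = bayes_class L f" "f \<in> bayes_densities L"
    by (auto simp: bayes2_space_def bayes_space_def bayes_class_def elim: quotientE)
  with assms bayes_class_self[OF f(2)] show thesis
    by (intro that[of f]) (auto simp: bayes2_space_def)
qed

lemma integrable_power2_add:
  fixes u v :: "'a \<Rightarrow> real"
  assumes [measurable]: "u \<in> borel_measurable L" "v \<in> borel_measurable L"
    and "integrable L (\<lambda>x. (u x)\<^sup>2)" "integrable L (\<lambda>x. (v x)\<^sup>2)"
  shows "integrable L (\<lambda>x. (u x + v x)\<^sup>2)"
proof (rule Bochner_Integration.integrable_bound)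
  show "integrable L (\<lambda>x. 2 * (u x)\<^sup>2 + 2 * (v x)\<^sup>2)"
    using assms by (intro Bochner_Integration.integrable_add integrable_mult_right) auto
  show "AE x in L. norm ((u x + v x)\<^sup>2) \<le> norm (2 * (u x)\<^sup>2 + 2 * (v x)\<^sup>2)"
  proof (rule AE_I2)
    fix x
    have "2 * (u x)\<^sup>2 + 2 * (v x)\<^sup>2 - (u x + v x)\<^sup>2 = (u x - v x)\<^sup>2"
      by (simp add: power2_eq_square algebra_simps)
    then have "(u x + v x)\<^sup>2 \<le> 2 * (u x)\<^sup>2 + 2 * (v x)\<^sup>2"
      using zero_le_power2[of "u x - v x"] by linarith
    then show "norm ((u x + v x)\<^sup>2) \<le> norm (2 * (u x)\<^sup>2 + 2 * (v x)\<^sup>2)"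
      by simp
  qed
qed measurable

lemma bayes_class_in_bayes2:
  assumes L: "finite_measure L" and f: "f \<in> bayes_densities L"
    and int: "integrable L (\<lambda>x. \<bar>ln (f x)\<bar>\<^sup>2)"
  shows "bayes_class L f \<in> bayes2_space L"
proof -
  interpret finite_measure L by fact
  note iff = bayes_densities_iff[OF sigma_finite_measure_axioms]
  have "integrable L (\<lambda>x. \<bar>ln (g x)\<bar>\<^sup>2)" if g: "g \<in> bayes_class L f" for g
  proof -
    obtain k :: real where k: "k > 0" "AE x in L. f x = k * g x"
      and D: "g \<in> bayes_densities L"
      using g by (auto simp: bayes_class_def bayes_rel_def)
    from f D have [measurable]: "f \<in> borel_measurable L" "g \<in> borel_measurable L"
      by (auto simp: iff)
    have "AE x in L. 0 < g x" using D by (simp add: iff)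
    with k(2) have "AE x in L. (ln (f x) + - ln k)\<^sup>2 = \<bar>ln (g x)\<bar>\<^sup>2"
      by eventually_elim (use k(1) in \<open>simp add: ln_mult\<close>)
    moreover have "integrable L (\<lambda>x. (ln (f x) + - ln k)\<^sup>2)"
      using int by (intro integrable_power2_add) auto
    ultimately show ?thesis
      by (subst integrable_cong_AE[where g = "\<lambda>x. (ln (f x) + - ln k)\<^sup>2"]) auto
  qed
  then show ?thesis using bayes_class_in_space[OF f] by (auto simp: bayes2_space_def)
qed

lemma abelian_group_bayes2:
  assumes "finite_measure L"
  shows "abelian_group (bayes2 L)"
proof -
  interpret finite_measure L by fact
  note sf = sigma_finite_measure_axioms
  note iff = bayes_densities_iff[OF sf]
  have mem: "(\<lambda>x. f x * g x) \<in> bayes_densities L"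
      "integrable L (\<lambda>x. \<bar>ln (f x * g x)\<bar>\<^sup>2)"
    if "f \<in> bayes_densities L" "integrable L (\<lambda>x. \<bar>ln (f x)\<bar>\<^sup>2)"
      "g \<in> bayes_densities L" "integrable L (\<lambda>x. \<bar>ln (g x)\<bar>\<^sup>2)" for f g
  proof -
    from that have [measurable]: "f \<in> borel_measurable L" "g \<in> borel_measurable L"
      and pos: "AE x in L. 0 < f x" "AE x in L. 0 < g x"
      by (auto simp: iff)
    have "AE x in L. \<bar>ln (f x * g x)\<bar>\<^sup>2 = (ln (f x) + ln (g x))\<^sup>2"
      using pos by eventually_elim (simp add: ln_mult)
    moreover have "integrable L (\<lambda>x. (ln (f x) + ln (g x))\<^sup>2)"
      using that by (intro integrable_power2_add) auto
    ultimately show "integrable L (\<lambda>x. \<bar>ln (f x * g x)\<bar>\<^sup>2)"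
      by (subst integrable_cong_AE[where g = "\<lambda>x. (ln (f x) + ln (g x))\<^sup>2"]) auto
    show "(\<lambda>x. f x * g x) \<in> bayes_densities L" using pos by (auto simp: iff)
  qed
  have one: "(\<lambda>_. 1) \<in> bayes_densities L" by (simp add: iff)
  show ?thesis
  proof (rule abelian_groupI; simp add: bayes2_def)
    fix A B assume "A \<in> bayes2_space L" "B \<in> bayes2_space L"
    then show "bayes_add L A B \<in> bayes2_space L"
      by (auto elim!: bayes2_classE simp: bayes_add_class[OF sf] mem mem[simplified]
               intro!: bayes_class_in_bayes2[OF assms])
  next
    show "bayes_class L (\<lambda>_. 1) \<in> bayes2_space L"
      by (rule bayes_class_in_bayes2[OF assms one]) simp
  next
    fix A B E assume "A \<in> bayes2_space L" "B \<in> bayes2_space L" "E \<in> bayes2_space L"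
    then show "bayes_add L (bayes_add L A B) E = bayes_add L A (bayes_add L B E)"
      by (auto elim!: bayes2_classE simp: bayes_add_class[OF sf] mem mult.assoc)
  next
    fix A B assume "A \<in> bayes2_space L" "B \<in> bayes2_space L"
    then show "bayes_add L A B = bayes_add L B A"
      by (auto elim!: bayes2_classE simp: bayes_add_class[OF sf] mem mult.commute)
  next
    fix A assume "A \<in> bayes2_space L"
    then show "bayes_add L (bayes_class L (\<lambda>_. 1)) A = A"
      by (auto elim!: bayes2_classE simp: bayes_add_class[OF sf] one)
  next
    fix A assume "A \<in> bayes2_space L"
    then obtain f where f: "A = bayes_class L f" "f \<in> bayes_densities L"
        "integrable L (\<lambda>x. \<bar>ln (f x)\<bar>\<^sup>2)"
      by (rule bayes2_classE)
    define g where "g = (\<lambda>x. 1 / f x)"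
    have [measurable]: "f \<in> borel_measurable L" and pos: "AE x in L. 0 < f x"
      using f(2) by (auto simp: iff)
    have g: "g \<in> bayes_densities L" using pos by (auto simp: iff g_def)
    have "AE x in L. \<bar>ln (g x)\<bar>\<^sup>2 = \<bar>ln (f x)\<bar>\<^sup>2"
      using pos by eventually_elim (simp add: g_def ln_div)
    then have "integrable L (\<lambda>x. \<bar>ln (g x)\<bar>\<^sup>2)"
      using f(3) by (subst integrable_cong_AE[where g = "\<lambda>x. \<bar>ln (f x)\<bar>\<^sup>2"])
        (auto simp: g_def)
    then have "bayes_class L g \<in> bayes2_space L"
      by (rule bayes_class_in_bayes2[OF assms g])
    moreover have "AE x in L. g x * f x = 1 * 1"
      using pos by eventually_elim (simp add: g_def)
    then have "bayes_class L (\<lambda>x. g x * f x) = bayes_class L (\<lambda>_. 1)"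
      using mem(1)[OF g \<open>integrable L (\<lambda>x. \<bar>ln (g x)\<bar>\<^sup>2)\<close> f(2,3)] one
      by (subst bayes_class_eq_iff) (auto intro!: exI[of _ 1])
    then have "bayes_add L (bayes_class L g) A = bayes_class L (\<lambda>_. 1)"
      by (simp add: f(1) bayes_add_class[OF sf g f(2)])
    ultimately show "\<exists>B\<in>bayes2_space L. bayes_add L B A = bayes_class L (\<lambda>_. 1)"
      by blast
  qed
qed


section \<open>Random vectors and copulas\<close>

text \<open>A vector indexed by \<open>D\<close> is a function in \<open>D \<rightarrow>\<^sub>E UNIV\<close>, i.e. one that is \<^term>\<open>undefined\<close>
  outside \<open>D\<close>, as in the space of \<^term>\<open>Pi\<^sub>M D N\<close>.\<close>

definition joint_law ::
  "'a measure \<Rightarrow> nat set \<Rightarrow> (nat \<Rightarrow> 'a \<Rightarrow> real) \<Rightarrow> (nat \<Rightarrow> real) measure" where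
  "joint_law M D X = distr M (\<Pi>\<^sub>M i\<in>D. borel) (\<lambda>\<omega>. \<lambda>i\<in>D. X i \<omega>)"

definition marginal_law :: "'a measure \<Rightarrow> (nat \<Rightarrow> 'a \<Rightarrow> real) \<Rightarrow> nat \<Rightarrow> real measure" where
  "marginal_law M X i = distr M borel (X i)"

definition indep_law ::
  "'a measure \<Rightarrow> nat set \<Rightarrow> (nat \<Rightarrow> 'a \<Rightarrow> real) \<Rightarrow> (nat \<Rightarrow> real) measure" where
  "indep_law M D X = (\<Pi>\<^sub>M i\<in>D. marginal_law M X i)"

definition marginal_cdfs ::
  "'a measure \<Rightarrow> nat set \<Rightarrow> (nat \<Rightarrow> 'a \<Rightarrow> real) \<Rightarrow> (nat \<Rightarrow> real) \<Rightarrow> (nat \<Rightarrow> real)" where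
  "marginal_cdfs M D X x = (\<lambda>i\<in>D. cdf (marginal_law M X i) (x i))"

text \<open>A support is a measurable set carrying all the mass; it is not required to be closed.  The
  smallest closed support is one.\<close>

definition is_support :: "'a measure \<Rightarrow> 'a set \<Rightarrow> bool" where
  "is_support \<mu> S \<longleftrightarrow> S \<in> sets \<mu> \<and> emeasure \<mu> (space \<mu> - S) = 0"

definition is_copula :: "nat set \<Rightarrow> ((nat \<Rightarrow> real) \<Rightarrow> real) \<Rightarrow> bool" where
  "is_copula D C \<longleftrightarrow>
     (\<exists>\<mu>. prob_space \<mu> \<and> sets \<mu> = sets (\<Pi>\<^sub>M i\<in>D. (borel :: real measure)) \<and>
          (\<forall>i\<in>D. distr \<mu> borel (\<lambda>x. x i) = uniform_measure lborel {0..1}) \<and>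
          (\<forall>u\<in>D \<rightarrow>\<^sub>E {0..1}. C u = measure \<mu> {x\<in>space \<mu>. \<forall>i\<in>D. x i \<le> u i}))"

definition is_copula_of ::
  "((nat \<Rightarrow> real) \<Rightarrow> real) \<Rightarrow> 'a measure \<Rightarrow> nat set \<Rightarrow> (nat \<Rightarrow> 'a \<Rightarrow> real) \<Rightarrow> bool" where
  "is_copula_of C M D X \<longleftrightarrow>
     is_copula D C \<and>
     (\<forall>x. measure M {\<omega>\<in>space M. \<forall>i\<in>D. X i \<omega> \<le> x i} = C (marginal_cdfs M D X x))"

text \<open>Lebesgue measure on \<open>[0,1]\<^sup>D\<close>.\<close>

definition cube_lebesgue :: "nat set \<Rightarrow> (nat \<Rightarrow> real) measure" where
  "cube_lebesgue D = (\<Pi>\<^sub>M i\<in>D. restrict_space lborel {0..1})"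

definition is_copula_density ::
  "nat set \<Rightarrow> ((nat \<Rightarrow> real) \<Rightarrow> real) \<Rightarrow> ((nat \<Rightarrow> real) \<Rightarrow> real) \<Rightarrow> bool" where
  "is_copula_density D C c \<longleftrightarrow>
     c \<in> borel_measurable (cube_lebesgue D) \<and> (AE x in cube_lebesgue D. 0 \<le> c x) \<and>
     (\<forall>u\<in>D \<rightarrow>\<^sub>E {0..1}.
        ennreal (C u) = (\<integral>\<^sup>+x\<in>{x. \<forall>i\<in>D. x i \<le> u i}. ennreal (c x) \<partial>cube_lebesgue D))"


section \<open>Geometric margins, independence part and interaction parts\<close>

text \<open>The geometric margin is a function of the coordinates in \<open>I\<close> only, regarded as a function on
  the whole cube; \<^const>\<open>merge\<close> glues \<open>x\<close> on \<open>I\<close> and \<open>y\<close> on \<open>D - I\<close>.  It is used for nonempty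
  \<open>I \<subseteq> D\<close>.\<close>

definition geo_margin ::
  "nat set \<Rightarrow> ((nat \<Rightarrow> real) \<Rightarrow> real) \<Rightarrow> nat set \<Rightarrow> (nat \<Rightarrow> real) \<Rightarrow> real" where
  "geo_margin D c I =
     (if I = D then c
      else (\<lambda>x. exp (\<integral>y. ln (c (merge I (D - I) (x, y))) \<partial>cube_lebesgue (D - I))))"

definition geo_margin_class ::
  "nat set \<Rightarrow> ((nat \<Rightarrow> real) \<Rightarrow> real) \<Rightarrow> nat set \<Rightarrow> ((nat \<Rightarrow> real) \<Rightarrow> real) set" where
  "geo_margin_class D c I = bayes_class (cube_lebesgue D) (geo_margin D c I)"

definition ind_part ::
  "nat set \<Rightarrow> ((nat \<Rightarrow> real) \<Rightarrow> real) \<Rightarrow> ((nat \<Rightarrow> real) \<Rightarrow> real) set" where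
  "ind_part D c = (\<Oplus>\<^bsub>bayes2 (cube_lebesgue D)\<^esub>i\<in>D. geo_margin_class D c {i})"

definition int_part ::
  "nat set \<Rightarrow> ((nat \<Rightarrow> real) \<Rightarrow> real) \<Rightarrow> nat set \<Rightarrow> ((nat \<Rightarrow> real) \<Rightarrow> real) set" where
  "int_part D c I =
     (\<Oplus>\<^bsub>bayes2 (cube_lebesgue D)\<^esub>J\<in>{J. J \<subseteq> I \<and> J \<noteq> {}}.
        (- 1) ^ card (I - J) \<odot>\<^bsub>bayes2 (cube_lebesgue D)\<^esub> geo_margin_class D c J)"

end

theory Submission
  imports Defs
begin

text \<open>
  Write \<open>Q\<close> for Lebesgue measure on the cube.  The decomposition is Moebius inversion over the
  lattice of subsets of \<open>D\<close>, applied to the functions \<open>ln c\<^sub>J\<close> and carried from \<open>Q\<close> to \<open>P\<close> by the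
  map \<open>F\<close>.

  On the cube, Bayes addition is multiplication of densities, so both parts are classes of explicit
  finite products of powers of the geometric margins \<open>c\<^sub>J\<close>.  For \<open>|I| \<ge> 2\<close> the logarithm of the
  \<open>I\<close>-th interaction part is \<open>T I = (\<Sum>J. (-1) ^ |I - J| * ln c\<^sub>J)\<close>, the sum running over
  \<open>{} \<noteq> J \<subseteq> I\<close>; for \<open>I = {i}\<close> the same formula gives \<open>ln c\<^sub>i\<close>.  The logarithm of the right-hand
  side is therefore the sum of \<open>T I\<close> over all \<open>{} \<noteq> I \<subseteq> D\<close>, and inversion collapses it to
  \<open>ln c\<^sub>D = ln c\<close> (\<open>prod_interactions\<close>).  The identity holds pointwise wherever all margins are
  positive, that is, almost everywhere.

  Two analytic facts make this an identity in the vector space \<open>B\<^sup>2\<close>.  Firstly, every geometric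
  margin is an element of \<open>B\<^sup>2(Q)\<close>: its logarithm is a partial integral of \<open>ln c\<close>, and integrating
  out coordinates against a probability measure contracts the \<open>L\<^sup>2\<close> norm
  (\<open>partial_integral_L2\<close>).  Secondly, \<open>F\<close> pushes \<open>P\<close> forward to \<open>Q\<close>: each \<open>X i\<close> has a density,
  hence a continuous distribution function, so the probability integral transform applies in each
  coordinate (\<open>distr_cdf\<close>, \<open>distr_PiM_coordinatewise\<close>), and the support is a box of full mass under
  the product of the margins as well (\<open>indep_law_support\<close>).  Composition with a measure preserving
  map acts on representatives, preserves products and square integrability of logarithms, and
  transports almost-everywhere identities.
\<close>

section \<open>Calculus of Bayes classes\<close>

text \<open>The representatives of elements of \<open>B\<^sup>2\<close>.  Since the vector space operations act on
  representatives, membership and equality of classes can be settled for functions.\<close>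

definition log_L2_densities :: "'a measure \<Rightarrow> ('a \<Rightarrow> real) set" where
  "log_L2_densities L =
     {f \<in> borel_measurable L. (AE x in L. 0 < f x) \<and> integrable L (\<lambda>x. (ln (f x))\<^sup>2)}"

lemma log_L2_densities_in_bayes_densities:
  assumes "finite_measure L" "f \<in> log_L2_densities L"
  shows "f \<in> bayes_densities L"
proof -
  interpret finite_measure L by fact
  show ?thesis
    using assms(2) by (simp add: bayes_densities_iff[OF sigma_finite_measure_axioms] log_L2_densities_def)
qed

lemma bayes_class_in_carrier:
  assumes "finite_measure L" "f \<in> log_L2_densities L"
  shows "bayes_class L f \<in> carrier (bayes2 L)"
  using bayes_class_in_bayes2[OF assms(1) log_L2_densities_in_bayes_densities[OF assms]] assms(2)
  by (simp add: bayes2_def log_L2_densities_def)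

lemma bayes_class_cong_AE:
  assumes L: "finite_measure L" and f: "f \<in> log_L2_densities L" and g: "g \<in> log_L2_densities L"
    and eq: "AE x in L. f x = g x"
  shows "bayes_class L f = bayes_class L g"
  using bayes_class_eq_iff[OF log_L2_densities_in_bayes_densities[OF L f] log_L2_densities_in_bayes_densities[OF L g]] eq
  by (auto intro!: exI[of _ 1])

lemma log_L2_densities_one: "(\<lambda>_. 1) \<in> log_L2_densities L"
  by (simp add: log_L2_densities_def)

lemma log_L2_densities_mult:
  assumes f: "f \<in> log_L2_densities L" and g: "g \<in> log_L2_densities L"
  shows "(\<lambda>x. f x * g x) \<in> log_L2_densities L"
proof -
  have [measurable]: "f \<in> borel_measurable L" "g \<in> borel_measurable L"
    and pos: "AE x in L. 0 < f x" "AE x in L. 0 < g x"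
    using f g by (auto simp: log_L2_densities_def)
  have "AE x in L. (ln (f x * g x))\<^sup>2 = (ln (f x) + ln (g x))\<^sup>2"
    using pos by eventually_elim (simp add: ln_mult)
  moreover have "integrable L (\<lambda>x. (ln (f x) + ln (g x))\<^sup>2)"
    using f g by (intro integrable_power2_add) (auto simp: log_L2_densities_def)
  ultimately have "integrable L (\<lambda>x. (ln (f x * g x))\<^sup>2)"
    by (subst integrable_cong_AE[where g = "\<lambda>x. (ln (f x) + ln (g x))\<^sup>2"]) auto
  then show ?thesis
    using pos by (auto simp: log_L2_densities_def)
qed

lemma log_L2_densities_powr:
  assumes "f \<in> log_L2_densities L"
  shows "(\<lambda>x. f x powr a) \<in> log_L2_densities L"
proof -
  have [measurable]: "f \<in> borel_measurable L" and pos: "AE x in L. 0 < f x"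
    and int: "integrable L (\<lambda>x. (ln (f x))\<^sup>2)"
    using assms by (auto simp: log_L2_densities_def)
  have "AE x in L. (ln (f x powr a))\<^sup>2 = a\<^sup>2 * (ln (f x))\<^sup>2"
    using pos by eventually_elim (simp add: ln_powr power_mult_distrib)
  then have "integrable L (\<lambda>x. (ln (f x powr a))\<^sup>2)"
    using int by (subst integrable_cong_AE[where g = "\<lambda>x. a\<^sup>2 * (ln (f x))\<^sup>2"]) auto
  then show ?thesis
    using pos by (auto simp: log_L2_densities_def)
qed

lemma log_L2_densities_prod:
  assumes "finite A" "\<And>i. i \<in> A \<Longrightarrow> f i \<in> log_L2_densities L"
  shows "(\<lambda>x. \<Prod>i\<in>A. f i x) \<in> log_L2_densities L"
  using assms
proof (induction A rule: finite_induct)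
  case empty
  show ?case using log_L2_densities_one by simp
next
  case (insert a A)
  then show ?case
    using log_L2_densities_mult[of "f a" L "\<lambda>x. \<Prod>i\<in>A. f i x"] by simp
qed

lemma bayes2_add_class:
  assumes L: "finite_measure L" and f: "f \<in> log_L2_densities L" and g: "g \<in> log_L2_densities L"
  shows "bayes_class L f \<oplus>\<^bsub>bayes2 L\<^esub> bayes_class L g = bayes_class L (\<lambda>x. f x * g x)"
proof -
  interpret finite_measure L by fact
  show ?thesis
    using bayes_add_class[OF sigma_finite_measure_axioms
        log_L2_densities_in_bayes_densities[OF L f] log_L2_densities_in_bayes_densities[OF L g]]
    by (simp add: bayes2_def)
qed

lemma bayes2_smult_class:
  assumes L: "finite_measure L" and f: "f \<in> log_L2_densities L"
  shows "a \<odot>\<^bsub>bayes2 L\<^esub> bayes_class L f = bayes_class L (\<lambda>x. f x powr a)"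
proof -
  interpret finite_measure L by fact
  show ?thesis
    using bayes_smult_class[OF sigma_finite_measure_axioms log_L2_densities_in_bayes_densities[OF L f]]
    by (simp add: bayes2_def)
qed

lemma bayes2_finsum_class:
  assumes L: "finite_measure L" and "finite A" "\<And>i. i \<in> A \<Longrightarrow> f i \<in> log_L2_densities L"
  shows "(\<Oplus>\<^bsub>bayes2 L\<^esub>i\<in>A. bayes_class L (f i)) = bayes_class L (\<lambda>x. \<Prod>i\<in>A. f i x)"
proof -
  interpret abelian_group "bayes2 L" by (rule abelian_group_bayes2[OF L])
  show ?thesis
    using assms(2,3)
  proof (induction A rule: finite_induct)
    case empty
    have "\<zero>\<^bsub>bayes2 L\<^esub> = bayes_class L (\<lambda>_. 1)" by (simp add: bayes2_def)
    then show ?case by simp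
  next
    case (insert a A)
    have "(\<Oplus>\<^bsub>bayes2 L\<^esub>i\<in>insert a A. bayes_class L (f i)) =
        bayes_class L (f a) \<oplus>\<^bsub>bayes2 L\<^esub> (\<Oplus>\<^bsub>bayes2 L\<^esub>i\<in>A. bayes_class L (f i))"
      using insert by (intro finsum_insert) (auto intro: bayes_class_in_carrier[OF L])
    also have "\<dots> = bayes_class L (f a) \<oplus>\<^bsub>bayes2 L\<^esub> bayes_class L (\<lambda>x. \<Prod>i\<in>A. f i x)"
      using insert by simp
    also have "\<dots> = bayes_class L (\<lambda>x. f a x * (\<Prod>i\<in>A. f i x))"
      using insert by (intro bayes2_add_class[OF L] log_L2_densities_prod) auto
    finally show ?case using insert by simp
  qed
qed

lemma log_L2_densities_comp:
  assumes T: "T \<in> measurable P Q" "distr P Q T = Q" and g: "g \<in> log_L2_densities Q"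
  shows "(\<lambda>x. g (T x)) \<in> log_L2_densities P"
proof -
  have [measurable]: "g \<in> borel_measurable Q"
    and pos: "AE x in distr P Q T. 0 < g x"
    and int: "integrable (distr P Q T) (\<lambda>x. (ln (g x))\<^sup>2)"
    using g unfolding T(2) by (auto simp: log_L2_densities_def)
  note T(1)[measurable]
  show ?thesis
    using AE_distrD[OF T(1) pos] integrable_distr[OF T(1) int]
    by (simp add: log_L2_densities_def)
qed

text \<open>Two representatives of a class agree up to a factor almost everywhere with respect to \<open>Q\<close>; as \<open>T\<close> pushes
  \<open>P\<close> forward to \<open>Q\<close>, no exceptional null set can be hit with positive \<open>P\<close>-mass.  Hence composition
  of a class with \<open>T\<close> can be computed on any one representative.\<close>

lemma bayes_comp_class:
  assumes P: "finite_measure P" and Q: "finite_measure Q"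
    and T: "T \<in> measurable P Q" "distr P Q T = Q" and g: "g \<in> log_L2_densities Q"
  shows "bayes_comp P (bayes_class Q g) T = bayes_class P (\<lambda>x. g (T x))"
proof -
  interpret P: finite_measure P by fact
  interpret Q: finite_measure Q by fact
  have dens: "(\<lambda>x. h (T x)) \<in> bayes_densities P" if "h \<in> bayes_densities Q" for h
  proof -
    from that have [measurable]: "h \<in> borel_measurable Q" and pos: "AE x in distr P Q T. 0 < h x"
      unfolding T(2) by (auto simp: bayes_densities_iff[OF Q.sigma_finite_measure_axioms])
    note T(1)[measurable]
    show ?thesis
      using AE_distrD[OF T(1) pos] by (simp add: bayes_densities_iff[OF P.sigma_finite_measure_axioms])
  qed
  have g': "g \<in> bayes_densities Q" by (rule log_L2_densities_in_bayes_densities[OF Q g])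
  have "bayes_class P (\<lambda>x. h (T x)) = bayes_class P (\<lambda>x. g (T x))" if h: "h \<in> bayes_class Q g" for h
  proof -
    obtain k :: real where k: "k > 0" "AE x in distr P Q T. g x = k * h x" and D: "h \<in> bayes_densities Q"
      using h unfolding T(2) by (auto simp: bayes_class_def bayes_rel_def)
    have "bayes_class P (\<lambda>x. g (T x)) = bayes_class P (\<lambda>x. h (T x))"
      using k(1) AE_distrD[OF T(1) k(2)] by (subst bayes_class_eq_iff[OF dens[OF g'] dens[OF D]]) blast
    then show ?thesis by simp
  qed
  then show ?thesis
    using bayes_class_self[OF g'] unfolding bayes_comp_def by blast
qed

section \<open>Integrating out coordinates\<close>

lemma (in prob_space) square_expectation_le:
  fixes h :: "'a \<Rightarrow> real"
  assumes "integrable M h" "integrable M (\<lambda>x. (h x)\<^sup>2)"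
  shows "(expectation h)\<^sup>2 \<le> expectation (\<lambda>x. (h x)\<^sup>2)"
  using variance_positive[of h] variance_eq[OF assms] by simp

lemma integrable_of_square:
  fixes h :: "'a \<Rightarrow> real"
  assumes L: "finite_measure L" and [measurable]: "h \<in> borel_measurable L"
    and int: "integrable L (\<lambda>x. (h x)\<^sup>2)"
  shows "integrable L h"
proof (rule Bochner_Integration.integrable_bound)
  interpret finite_measure L by fact
  show "integrable L (\<lambda>x. 1 + (h x)\<^sup>2)" using int by simp
  have "\<bar>t\<bar> \<le> 1 + t\<^sup>2" for t :: real
  proof -
    have "0 \<le> (\<bar>t\<bar> - 1)\<^sup>2" by simp
    then show ?thesis by (simp add: power2_diff)
  qed
  then show "AE x in L. norm (h x) \<le> norm (1 + (h x)\<^sup>2)"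
    by (auto intro: order_trans)
qed measurable

text \<open>Gluing coordinates by \<^const>\<open>merge\<close> identifies the product over \<open>K\<close> with a product of two
  probability spaces.  Fubini makes almost every slice of \<open>h\<close> and of \<open>h\<^sup>2\<close> integrable, and Jensen's
  inequality on each slice bounds the square of the partial integral by the partial integral of the
  square.  The bound is first obtained over \<open>J\<close> and then pulled back along the measure preserving
  restriction from \<open>K\<close>.\<close>

lemma (in product_prob_space) partial_integral_L2:
  fixes h :: "('i \<Rightarrow> 'a) \<Rightarrow> real"
  assumes K: "finite K" and J: "J \<subseteq> K"
    and h[measurable]: "h \<in> borel_measurable (Pi\<^sub>M K M)"
    and int: "integrable (Pi\<^sub>M K M) (\<lambda>x. (h x)\<^sup>2)"
  defines "E \<equiv> \<lambda>x. \<integral>y. h (merge J (K - J) (x, y)) \<partial>Pi\<^sub>M (K - J) M"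
  shows "E \<in> borel_measurable (Pi\<^sub>M K M)" "integrable (Pi\<^sub>M K M) (\<lambda>x. (E x)\<^sup>2)"
proof -
  let ?J = "Pi\<^sub>M J M" and ?R = "Pi\<^sub>M (K - J) M" and ?K = "Pi\<^sub>M K M"
  let ?r = "\<lambda>x. restrict x J"
  interpret J: prob_space ?J by (rule prob_space_PiM[OF prob_space])
  interpret R: prob_space ?R by (rule prob_space_PiM[OF prob_space])
  interpret JR: pair_prob_space ?J ?R ..
  have KJ: "J \<union> (K - J) = K" using J by auto
  have fin: "finite J" "finite (K - J)" using K J by (auto intro: finite_subset)
  have mrg[measurable]: "merge J (K - J) \<in> measurable (?J \<Otimes>\<^sub>M ?R) ?K"
    using measurable_merge[of J "K - J" M] KJ by simp
  have distr: "distr (?J \<Otimes>\<^sub>M ?R) ?K (merge J (K - J)) = ?K"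
    using distr_merge[OF _ fin] KJ by simp
  have res[measurable]: "?r \<in> measurable ?K ?J"
    by (rule measurable_restrict_subset[OF J])
  \<comment> \<open>\<open>merge\<close> reads its first argument only inside \<open>J\<close>.\<close>
  have E_res: "E x = E (?r x)" for x
    by (simp add: E_def merge_def cong: if_cong)
  have h2: "integrable (?J \<Otimes>\<^sub>M ?R) (\<lambda>z. (h (merge J (K - J) z))\<^sup>2)"
    by (rule integrable_distr[OF mrg]) (simp add: distr int)
  have h1: "integrable (?J \<Otimes>\<^sub>M ?R) (\<lambda>z. h (merge J (K - J) z))"
    by (rule integrable_of_square[OF _ _ h2]) (auto intro: JR.finite_measure_axioms)
  have EJ[measurable]: "E \<in> borel_measurable ?J"
    unfolding E_def by (rule R.borel_measurable_lebesgue_integral) simp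
  show "E \<in> borel_measurable ?K"
    using measurable_compose[OF res EJ] by (simp add: E_res[symmetric])
  have bound: "AE x in ?J. norm ((E x)\<^sup>2) \<le> norm (\<integral>y. (h (merge J (K - J) (x, y)))\<^sup>2 \<partial>?R)"
    using JR.AE_integrable_fst'[OF h1] JR.AE_integrable_fst'[OF h2]
    by eventually_elim (use R.square_expectation_le in \<open>force simp: E_def\<close>)
  have "integrable ?J (\<lambda>x. (E x)\<^sup>2)"
    by (rule Bochner_Integration.integrable_bound[OF JR.integrable_fst'[OF h2] _ bound]) measurable
  then have "integrable (distr ?K ?J ?r) (\<lambda>x. (E x)\<^sup>2)"
    using distr_restrict[OF J K] by simp
  then have "integrable ?K (\<lambda>x. (E (?r x))\<^sup>2)"
    by (rule integrable_distr[OF res])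
  then show "integrable ?K (\<lambda>x. (E x)\<^sup>2)" by (simp add: E_res[symmetric])
qed

lemma prob_space_unit_interval: "prob_space (restrict_space lborel {0..1::real})"
  by (rule prob_spaceI) (simp add: emeasure_restrict_space)

lemma prob_space_cube_lebesgue: "prob_space (cube_lebesgue D)"
  unfolding cube_lebesgue_def by (rule prob_space_PiM[OF prob_space_unit_interval])

lemma geo_margin_in_log_L2:
  assumes D: "finite D" and J: "J \<subseteq> D" and c: "c \<in> log_L2_densities (cube_lebesgue D)"
  shows "geo_margin D c J \<in> log_L2_densities (cube_lebesgue D)"
proof (cases "J = D")
  case True
  then show ?thesis using c by (simp add: geo_margin_def)
next
  case False
  interpret product_prob_space "\<lambda>_. restrict_space lborel {0..1::real}"
    by (rule product_prob_spaceI[OF prob_space_unit_interval])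
  have "(\<lambda>u. ln (c u)) \<in> borel_measurable (cube_lebesgue D)"
      "integrable (cube_lebesgue D) (\<lambda>u. (ln (c u))\<^sup>2)"
    using c by (auto simp: log_L2_densities_def)
  from partial_integral_L2[OF D J this[unfolded cube_lebesgue_def]] False show ?thesis
    by (simp add: log_L2_densities_def geo_margin_def cube_lebesgue_def)
qed

section \<open>The probability integral transform\<close>

text \<open>The distribution function need not be strictly increasing, so the sublevel set is not
  \<open>{..t}\<close> for every \<open>t\<close> with \<open>cdf M t = u\<close>.  By continuity and monotonicity it is \<open>{..s}\<close> for its
  supremum \<open>s\<close>, and the intermediate value theorem forces the value \<open>u\<close> at \<open>s\<close>.\<close>

lemma (in real_distribution) measure_cdf_le:
  assumes cont: "\<And>x. isCont (cdf M) x" and u: "0 < u" "u < 1"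
  shows "measure M {x. cdf M x \<le> u} = u"
proof -
  have "eventually (\<lambda>x. cdf M x < u) at_bot"
    by (rule order_tendstoD(2)[OF cdf_lim_at_bot u(1)])
  then obtain a where a: "cdf M a < u" by (auto simp: eventually_at_bot_linorder)
  have "eventually (\<lambda>x. u < cdf M x) at_top"
    by (rule order_tendstoD(1)[OF cdf_lim_at_top_prob u(2)])
  then obtain b where b: "u < cdf M b" by (auto simp: eventually_at_top_linorder)
  let ?S = "{x. cdf M x \<le> u}"
  have ub: "x \<le> b" if "x \<in> ?S" for x
    using that b cdf_nondecreasing[of b x] by (cases "x \<le> b") auto
  then have bdd: "bdd_above ?S" by (auto simp: bdd_above_def)
  have closed: "closed ?S"
    by (intro closed_Collect_le continuous_at_imp_continuous_on ballI cont continuous_on_const)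
  define s where "s = Sup ?S"
  have "a \<in> ?S" using a by simp
  then have "?S \<noteq> {}" by blast
  from closed_contains_Sup[OF this bdd closed] have s: "cdf M s \<le> u"
    by (simp add: s_def)
  have S: "?S = {..s}"
  proof (intro Set.set_eqI iffI)
    fix x assume "x \<in> ?S"
    then show "x \<in> {..s}" using cSup_upper[OF _ bdd] by (simp add: s_def)
  next
    fix x assume "x \<in> {..s}"
    then show "x \<in> ?S" using s cdf_nondecreasing[of x s] by simp
  qed
  have "s \<le> b" using ub s by simp
  then obtain t where t: "s \<le> t" "cdf M t = u"
    using IVT[of "cdf M" s u b] s b cont by auto
  then have "t = s" using S by (metis atMost_iff mem_Collect_eq order_antisym order_refl)
  then show ?thesis using t S by (simp add: cdf_def2)
qed

text \<open>The probability integral transform.  The transformed law and the uniform law are compared through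
  their distribution functions, on the whole line so that uniqueness of the law with a given
  distribution function applies; both are then restricted to the unit interval.\<close>

lemma (in real_distribution) distr_cdf:
  assumes cont: "\<And>x. isCont (cdf M) x"
  shows "distr M (restrict_space lborel {0..1}) (cdf M) = restrict_space lborel {0..1}"
    and "cdf M \<in> measurable M (restrict_space lborel {0..1})"
proof -
  let ?G = "distr M borel (cdf M)"
  let ?U = "distr (restrict_space lborel {0..1}) borel (\<lambda>x. x) :: real measure"
  have m_borel[measurable]: "cdf M \<in> borel_measurable borel"
    by (intro borel_measurable_continuous_onI continuous_at_imp_continuous_on ballI cont)
  have range: "cdf M \<in> space M \<rightarrow> {0..1}"
    by (auto simp: cdf_nonneg cdf_bounded_prob)
  show m[measurable]: "cdf M \<in> measurable M (restrict_space lborel {0..1})"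
    by (rule measurable_restrict_space2[OF range]) simp
  have id[measurable]: "(\<lambda>x. x) \<in> borel_measurable (restrict_space lborel {0..1::real})"
    by (rule measurable_restrict_space1) simp
  interpret U0: prob_space "restrict_space lborel {0..1::real}" by (rule prob_space_unit_interval)
  interpret U: real_distribution ?U
    by (intro real_distribution.intro U0.prob_space_distr id real_distribution_axioms.intro) simp
  interpret G: real_distribution ?G
    by (intro real_distribution.intro prob_space_distr real_distribution_axioms.intro) auto
  have cdfG: "cdf ?G u = measure M {x. cdf M x \<le> u}" for u
    by (simp add: cdf_def2[of ?G] measure_distr vimage_def)
  have inner: "cdf ?G u = u" if "0 < u" "u < 1" for u
    using measure_cdf_le[OF cont that] by (simp add: cdfG)
  have cdfU: "cdf ?U u = (if u \<le> 0 then 0 else if u < 1 then u else 1)" for u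
  proof -
    have "cdf ?U u = measure lborel ({..u} \<inter> {0..1})"
      by (simp add: cdf_def2 measure_distr space_restrict_space measure_restrict_space)
    also have "{..u} \<inter> {0..1} = (if u < 0 then {} else {0..min u 1})" by auto
    finally show ?thesis by (auto simp: min_def)
  qed
  have "cdf ?G = cdf ?U"
  proof
    fix u :: real
    consider "u \<le> 0" | "0 < u" "u < 1" | "1 \<le> u" by linarith
    then show "cdf ?G u = cdf ?U u"
    proof cases
      case 1
      \<comment> \<open>The value at a nonpositive point is squeezed below the values \<open>e\<close> at small positive \<open>e\<close>.\<close>
      have "cdf ?G u \<le> e" if "0 < e" for e
      proof -
        have "cdf ?G u \<le> cdf ?G (min e (1/2))"
          using 1 that by (intro G.cdf_nondecreasing) auto
        also have "\<dots> \<le> e" using that by (subst inner) auto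
        finally show ?thesis .
      qed
      then have "cdf ?G u \<le> 0" by (rule dense_ge)
      then show ?thesis using 1 G.cdf_nonneg[of u] by (simp add: cdfU)
    next
      case 2
      then show ?thesis by (simp add: inner cdfU)
    next
      case 3
      then have "{x. cdf M x \<le> u} = space M"
        using cdf_bounded_prob order_trans by auto
      then show ?thesis using 3 prob_space by (simp add: cdfG cdfU)
    qed
  qed
  then have eq: "?G = ?U"
    by (intro cdf_unique) (unfold_locales)
  have "distr M (restrict_space lborel {0..1}) (cdf M) = restrict_space ?G {0..1}"
    using range by (subst restrict_distr) (auto intro!: distr_cong simp: sets_restrict_space)
  also have "\<dots> = restrict_space ?U {0..1}" by (simp add: eq)
  also have "\<dots> = distr (restrict_space lborel {0..1}) (restrict_space borel {0..1}) (\<lambda>x. x)"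
    by (subst restrict_distr) (auto simp: space_restrict_space)
  also have "\<dots> = restrict_space lborel {0..1}"
    by (rule distr_id2) (simp add: sets_restrict_space)
  finally show "distr M (restrict_space lborel {0..1}) (cdf M) = restrict_space lborel {0..1}" .
qed

section \<open>The marginal distribution functions preserve measure\<close>

lemma emeasure_PiM_box:
  assumes "finite I" "\<And>i. i \<in> I \<Longrightarrow> prob_space (M i)" "\<And>i. i \<in> I \<Longrightarrow> A i \<in> sets (M i)"
  shows "emeasure (Pi\<^sub>M I M) (Pi\<^sub>E I A) = (\<Prod>i\<in>I. emeasure (M i) (A i))"
  using emeasure_PiM_emb[of I M I A] assms
  by (simp add: prod_emb_PiE_same_index sets.sets_into_space)

lemma distr_PiM_coordinatewise:
  assumes I: "finite I" and M: "\<And>i. i \<in> I \<Longrightarrow> prob_space (M i)"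
    and N: "product_sigma_finite N"
    and f: "\<And>i. i \<in> I \<Longrightarrow> f i \<in> measurable (M i) (N i)"
    and eq: "\<And>i. i \<in> I \<Longrightarrow> distr (M i) (N i) (f i) = N i"
  shows "distr (Pi\<^sub>M I M) (Pi\<^sub>M I N) (\<lambda>x. \<lambda>i\<in>I. f i (x i)) = Pi\<^sub>M I N"
    and "(\<lambda>x. \<lambda>i\<in>I. f i (x i)) \<in> measurable (Pi\<^sub>M I M) (Pi\<^sub>M I N)"
proof -
  interpret N: product_sigma_finite N by fact
  let ?F = "\<lambda>x. \<lambda>i\<in>I. f i (x i)"
  show F: "?F \<in> measurable (Pi\<^sub>M I M) (Pi\<^sub>M I N)"
  proof (rule measurable_restrict)
    show "(\<lambda>x. f i (x i)) \<in> measurable (Pi\<^sub>M I M) (N i)" if "i \<in> I" for i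
      by (rule measurable_compose[OF measurable_component_singleton[where M = M, OF that] f[OF that]])
  qed
  show "distr (Pi\<^sub>M I M) (Pi\<^sub>M I N) ?F = Pi\<^sub>M I N"
  proof (rule N.PiM_eqI[OF I])
    fix A assume A: "\<And>i. i \<in> I \<Longrightarrow> A i \<in> sets (N i)"
    let ?B = "\<lambda>i. f i -` A i \<inter> space (M i)"
    have pre: "?F -` Pi\<^sub>E I A \<inter> space (Pi\<^sub>M I M) = Pi\<^sub>E I ?B"
      by (auto simp: space_PiM PiE_iff)
    have "emeasure (distr (Pi\<^sub>M I M) (Pi\<^sub>M I N) ?F) (Pi\<^sub>E I A) = emeasure (Pi\<^sub>M I M) (Pi\<^sub>E I ?B)"
      using A I by (subst emeasure_distr[OF F]) (auto simp: pre)
    also have "\<dots> = (\<Prod>i\<in>I. emeasure (M i) (?B i))"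
      using A f by (intro emeasure_PiM_box I M) (auto intro: measurable_sets)
    also have "\<dots> = (\<Prod>i\<in>I. emeasure (N i) (A i))"
    proof (rule prod.cong[OF refl])
      fix i assume i: "i \<in> I"
      have "emeasure (distr (M i) (N i) (f i)) (A i) = emeasure (M i) (?B i)"
        by (rule emeasure_distr[OF f[OF i] A[OF i]])
      then show "emeasure (M i) (?B i) = emeasure (N i) (A i)" by (simp add: eq[OF i])
    qed
    finally show "emeasure (distr (Pi\<^sub>M I M) (Pi\<^sub>M I N) ?F) (Pi\<^sub>E I A) = (\<Prod>i\<in>I. emeasure (N i) (A i))" .
  qed simp
qed

lemma distr_restrict_space_AE:
  assumes S: "S \<in> sets L" and ae: "AE x in L. x \<in> S" and f: "f \<in> measurable L N"
  shows "distr (restrict_space L S) N f = distr L N f"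
proof (rule measure_eqI)
  fix A assume "A \<in> sets (distr (restrict_space L S) N f)"
  then have A: "A \<in> sets N" by simp
  have SL: "S \<subseteq> space L" using S by (rule sets.sets_into_space)
  have "emeasure (distr (restrict_space L S) N f) A = emeasure (restrict_space L S) (f -` A \<inter> S)"
    using SL by (simp add: emeasure_distr A measurable_restrict_space1[OF f] space_restrict_space Int_absorb2)
  also have "\<dots> = emeasure L (f -` A \<inter> S)"
    using SL S by (subst emeasure_restrict_space) (auto simp: Int_absorb2)
  also have "\<dots> = emeasure L (f -` A \<inter> space L)"
  proof (rule emeasure_eq_AE)
    show "AE x in L. x \<in> f -` A \<inter> S \<longleftrightarrow> x \<in> f -` A \<inter> space L"
      using ae AE_space by eventually_elim auto
    have "f -` A \<inter> S = (f -` A \<inter> space L) \<inter> S" using SL by auto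
    then show "f -` A \<inter> S \<in> sets L" using measurable_sets[OF f A] S by auto
  qed (rule measurable_sets[OF f A])
  also have "\<dots> = emeasure (distr L N f) A" by (simp add: emeasure_distr A f)
  finally show "emeasure (distr (restrict_space L S) N f) A = emeasure (distr L N f) A" .
qed simp

lemma prob_space_restrict_space_AE:
  assumes L: "prob_space L" and S: "S \<in> sets L" and ae: "AE x in L. x \<in> S"
  shows "prob_space (restrict_space L S)"
proof -
  interpret prob_space L by fact
  have "emeasure L S = 1" using S ae by (simp add: emeasure_eq_1_AE)
  then show ?thesis by (rule prob_space_restrict_space[OF S])
qed

text \<open>The \<open>i\<close>-th factor is the section of the box through a point of it, along the \<open>i\<close>-th coordinate
  axis.  An empty box says nothing about its factors, so such a point has to exist.\<close>

lemma factors_of_measurable_box: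
  fixes \<Omega> :: "'i \<Rightarrow> 'a::topological_space set"
  assumes S: "Pi\<^sub>E D \<Omega> \<in> sets (\<Pi>\<^sub>M i\<in>D. borel)" and ne: "Pi\<^sub>E D \<Omega> \<noteq> {}" and i: "i \<in> D"
  shows "\<Omega> i \<in> sets borel"
proof -
  obtain x where x: "x \<in> Pi\<^sub>E D \<Omega>" using ne by auto
  let ?f = "\<lambda>t. \<lambda>j\<in>D. if j = i then t else x j"
  have "?f \<in> measurable borel (\<Pi>\<^sub>M i\<in>D. borel)" by measurable
  from measurable_sets[OF this S] have "?f -` Pi\<^sub>E D \<Omega> \<in> sets borel" by simp
  also have "?f -` Pi\<^sub>E D \<Omega> = \<Omega> i"
    using x i by (auto simp: PiE_iff split: if_splits)
  finally show ?thesis .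
qed

lemma AE_marginal_law_support:
  assumes M: "prob_space M" and X: "\<And>i. i \<in> D \<Longrightarrow> X i \<in> borel_measurable M"
    and supp: "is_support (joint_law M D X) (Pi\<^sub>E D \<Omega>)" and i: "i \<in> D"
  shows "\<Omega> i \<in> sets borel" "AE t in marginal_law M X i. t \<in> \<Omega> i"
proof -
  interpret prob_space M by fact
  let ?X = "\<lambda>\<omega>. \<lambda>i\<in>D. X i \<omega>"
  have X_meas: "?X \<in> measurable M (\<Pi>\<^sub>M i\<in>D. borel)" using X by (intro measurable_restrict)
  have S: "Pi\<^sub>E D \<Omega> \<in> sets (\<Pi>\<^sub>M i\<in>D. borel)"
    and null: "emeasure (joint_law M D X) (space (joint_law M D X) - Pi\<^sub>E D \<Omega>) = 0"
    using supp by (auto simp: is_support_def joint_law_def)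
  have "AE x in joint_law M D X. x \<in> Pi\<^sub>E D \<Omega>"
    by (rule AE_I[where N = "space (joint_law M D X) - Pi\<^sub>E D \<Omega>"])
       (use null S in \<open>auto simp: joint_law_def\<close>)
  then have ae: "AE \<omega> in M. ?X \<omega> \<in> Pi\<^sub>E D \<Omega>"
    unfolding joint_law_def by (rule AE_distrD[OF X_meas])
  then have "Pi\<^sub>E D \<Omega> \<noteq> {}" using AE_False by fastforce
  from factors_of_measurable_box[OF S this i] show \<Omega>: "\<Omega> i \<in> sets borel" .
  have "AE \<omega> in M. X i \<omega> \<in> \<Omega> i"
    using ae by eventually_elim (use i in \<open>auto simp: PiE_iff\<close>)
  then show "AE t in marginal_law M X i. t \<in> \<Omega> i"
    unfolding marginal_law_def using \<Omega> X[OF i] by (subst AE_distr_iff) auto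
qed

text \<open>A law with a density gives no mass to points, and the distribution function jumps exactly at the
  atoms.\<close>

lemma marginal_law_of_density:
  assumes "prob_space M" "distributed M lborel (X i) g"
  shows "real_distribution (marginal_law M X i)" "isCont (cdf (marginal_law M X i)) x"
proof -
  interpret prob_space M by fact
  have X[measurable]: "X i \<in> borel_measurable M" using distributed_measurable[OF assms(2)] by simp
  show "real_distribution (marginal_law M X i)"
    unfolding marginal_law_def by (intro real_distribution_distr X)
  then interpret law: real_distribution "marginal_law M X i" .
  have "emeasure (marginal_law M X i) {x} = emeasure M (X i -` {x} \<inter> space M)"
    by (simp add: marginal_law_def emeasure_distr)
  also have "\<dots> = (\<integral>\<^sup>+y. g y * indicator {x} y \<partial>lborel)"
    by (rule distributed_emeasure[OF assms(2)]) simp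
  also have "\<dots> = 0"
    using distributed_borel_measurable[OF assms(2)] by (simp add: nn_integral_cong_AE[OF AE_mp[OF AE_lborel_singleton[of x]], of _ "\<lambda>_. 0"] )
  finally show "isCont (cdf (marginal_law M X i)) x" by (simp add: law.isCont_cdf measure_def)
qed

lemma marginal_cdfs_measure_preserving:
  assumes D: "finite D" and M: "prob_space M"
    and dist: "\<And>i. i \<in> D \<Longrightarrow> distributed M lborel (X i) (f i)"
  shows "marginal_cdfs M D X \<in> measurable (indep_law M D X) (cube_lebesgue D)"
    and "distr (indep_law M D X) (cube_lebesgue D) (marginal_cdfs M D X) = cube_lebesgue D"
proof -
  have law: "real_distribution (marginal_law M X i)" "isCont (cdf (marginal_law M X i)) t"
    if "i \<in> D" for i t
    using marginal_law_of_density[of M X i, OF M dist[OF that]] by auto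
  interpret U: product_prob_space "\<lambda>_. restrict_space lborel {0..1::real}"
    by (rule product_prob_spaceI[OF prob_space_unit_interval])
  have prob: "prob_space (marginal_law M X i)" if "i \<in> D" for i
    using law(1)[OF that] by (simp add: real_distribution_def)
  have F: "marginal_cdfs M D X = (\<lambda>x. \<lambda>i\<in>D. cdf (marginal_law M X i) (x i))"
    by (simp add: marginal_cdfs_def fun_eq_iff)
  have cdf: "cdf (marginal_law M X i) \<in> measurable (marginal_law M X i) (restrict_space lborel {0..1})"
      "distr (marginal_law M X i) (restrict_space lborel {0..1}) (cdf (marginal_law M X i)) =
        restrict_space lborel {0..1}" if "i \<in> D" for i
    using real_distribution.distr_cdf[OF law(1)[OF that] law(2)[OF that]] by auto
  note * = distr_PiM_coordinatewise[OF D prob U.product_sigma_finite_axioms cdf]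
  show "marginal_cdfs M D X \<in> measurable (indep_law M D X) (cube_lebesgue D)"
    using *(2) by (simp add: F indep_law_def cube_lebesgue_def)
  show "distr (indep_law M D X) (cube_lebesgue D) (marginal_cdfs M D X) = cube_lebesgue D"
    using *(1) by (simp add: F indep_law_def cube_lebesgue_def)
qed

text \<open>The box carries the joint law, so each factor carries the corresponding margin.  Finitely many
  exceptional null sets of margins pull back to null sets of the product of the margins, so the box
  carries this product too.\<close>

lemma indep_law_support:
  assumes D: "finite D" and M: "prob_space M"
    and X: "\<And>i. i \<in> D \<Longrightarrow> X i \<in> borel_measurable M"
    and supp: "is_support (joint_law M D X) (Pi\<^sub>E D \<Omega>)"
  shows "prob_space (indep_law M D X)" "Pi\<^sub>E D \<Omega> \<in> sets (indep_law M D X)"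
    "AE x in indep_law M D X. x \<in> Pi\<^sub>E D \<Omega>"
proof -
  interpret prob_space M by fact
  note \<Omega> = AE_marginal_law_support[OF M X supp]
  have law: "prob_space (marginal_law M X i)" if "i \<in> D" for i
    unfolding marginal_law_def by (rule prob_space_distr[OF X[OF that]])
  show "prob_space (indep_law M D X)"
    unfolding indep_law_def by (rule prob_space_PiM[OF law])
  show "Pi\<^sub>E D \<Omega> \<in> sets (indep_law M D X)"
    unfolding indep_law_def by (intro sets_PiM_I_finite D) (simp add: marginal_law_def \<Omega>(1))
  have "AE x in indep_law M D X. \<forall>i\<in>D. x i \<in> \<Omega> i"
    unfolding indep_law_def
    by (intro AE_finite_allI[OF D] AE_PiM_component law \<Omega>(2))
  moreover have "AE x in indep_law M D X. x \<in> space (indep_law M D X)" by (rule AE_space)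
  ultimately show "AE x in indep_law M D X. x \<in> Pi\<^sub>E D \<Omega>"
    by eventually_elim (auto simp: indep_law_def space_PiM PiE_iff)
qed

section \<open>Moebius inversion\<close>

text \<open>This is the symmetric form of inclusion-exclusion on the Boolean lattice, since
  \<open>(-1) ^ |I - J| = (-1) ^ |I| * (-1) ^ |J|\<close> for \<open>J \<subseteq> I\<close>.\<close>

lemma sum_Pow_alternating_Pow:
  fixes L :: "'i set \<Rightarrow> real"
  assumes "finite S"
  shows "(\<Sum>I\<in>Pow S. \<Sum>J\<in>Pow I. (- 1) ^ card (I - J) * L J) = L S"
proof -
  have "L S = (\<Sum>I\<in>Pow S. (- 1) ^ card I * (\<Sum>J\<in>Pow I. (- 1) ^ card J * L J))"
    by (rule inclusion_exclusion_symmetric) (use assms in auto)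
  also have "\<dots> = (\<Sum>I\<in>Pow S. \<Sum>J\<in>Pow I. (- 1) ^ card (I - J) * L J)"
  proof (intro sum.cong refl)
    fix I assume "I \<in> Pow S"
    then have fin: "finite I" using assms finite_subset by auto
    have "(- 1) ^ card I * ((- 1) ^ card J * L J) = (- 1) ^ card (I - J) * L J" if "J \<in> Pow I" for J
    proof -
      have J: "finite J" "J \<subseteq> I" using that fin finite_subset by auto
      then have "(- 1 :: real) ^ card I * (- 1) ^ card J = (- 1) ^ (card I - card J)"
        using card_mono[OF fin J(2)] by (simp add: power_add[symmetric] neg_one_power_add_eq_neg_one_power_diff)
      then show ?thesis using J by (simp add: card_Diff_subset mult.assoc[symmetric])
    qed
    then show "(- 1) ^ card I * (\<Sum>J\<in>Pow I. (- 1) ^ card J * L J) = (\<Sum>J\<in>Pow I. (- 1) ^ card (I - J) * L J)"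
      unfolding sum_distrib_left by (rule sum.cong[OF refl])
  qed
  finally show ?thesis by simp
qed

lemma prod_interactions:
  fixes g :: "'i set \<Rightarrow> real"
  assumes D: "finite D" "D \<noteq> {}" and g: "\<And>J. J \<subseteq> D \<Longrightarrow> J \<noteq> {} \<Longrightarrow> 0 < g J"
  shows "(\<Prod>i\<in>D. g {i}) *
      (\<Prod>I\<in>{I. I \<subseteq> D \<and> 2 \<le> card I}. \<Prod>J\<in>{J. J \<subseteq> I \<and> J \<noteq> {}}. g J powr ((- 1) ^ card (I - J))) = g D"
proof -
  \<comment> \<open>Setting \<open>L {} = 0\<close> lets \<open>J\<close> and \<open>I\<close> range over full power sets: the empty set contributes
      nothing as an inner index, and \<open>T {} = 0\<close>.\<close>
  define L where "L J = (if J = {} then 0 else ln (g J))" for J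
  define T where "T I = (\<Sum>J\<in>Pow I. (- 1) ^ card (I - J) * L J)" for I
  have finP: "finite {I. I \<subseteq> D \<and> 2 \<le> card I}" using D by auto
  have T_exp: "(\<Prod>J\<in>{J. J \<subseteq> I \<and> J \<noteq> {}}. g J powr ((- 1) ^ card (I - J))) = exp (T I)"
    if "I \<subseteq> D" for I
  proof -
    have finI: "finite I" using that D finite_subset by auto
    have "(\<Prod>J\<in>{J. J \<subseteq> I \<and> J \<noteq> {}}. g J powr ((- 1) ^ card (I - J))) =
        (\<Prod>J\<in>{J. J \<subseteq> I \<and> J \<noteq> {}}. exp ((- 1) ^ card (I - J) * L J))"
    proof (rule prod.cong[OF refl])
      fix J assume "J \<in> {J. J \<subseteq> I \<and> J \<noteq> {}}"
      moreover from this that have "0 < g J" by (intro g) auto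
      ultimately show "g J powr ((- 1) ^ card (I - J)) = exp ((- 1) ^ card (I - J) * L J)"
        by (auto simp: L_def powr_def)
    qed
    also have "\<dots> = exp (\<Sum>J\<in>{J. J \<subseteq> I \<and> J \<noteq> {}}. (- 1) ^ card (I - J) * L J)"
      using finI by (simp add: exp_sum)
    also have "(\<Sum>J\<in>{J. J \<subseteq> I \<and> J \<noteq> {}}. (- 1) ^ card (I - J) * L J) = T I"
      unfolding T_def by (rule sum.mono_neutral_left) (use finI in \<open>auto simp: L_def\<close>)
    finally show ?thesis .
  qed
  have T_single: "T {i} = L {i}" for i
    by (simp add: T_def Pow_insert L_def)
  have ind: "(\<Prod>i\<in>D. g {i}) = exp (\<Sum>i\<in>D. T {i})"
    using D g by (auto simp: exp_sum T_single L_def intro!: prod.cong)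
  have "L D = (\<Sum>I\<in>Pow D. T I)"
    unfolding T_def by (rule sum_Pow_alternating_Pow[OF D(1), symmetric])
  \<comment> \<open>A nonempty index is a singleton, giving a factor of the independence part, or has at least
      two elements.\<close>
  also have "\<dots> = (\<Sum>I\<in>(\<lambda>i. {i}) ` D \<union> {I. I \<subseteq> D \<and> 2 \<le> card I}. T I)"
  proof (rule sum.mono_neutral_right)
    have "T I = 0" if "I \<subseteq> D" "I \<notin> (\<lambda>i. {i}) ` D" "\<not> 2 \<le> card I" for I
    proof -
      have "finite I" using that D finite_subset by auto
      moreover have "card I \<noteq> 1" using that(1,2) by (auto simp: card_1_singleton_iff)
      then have "card I = 0" using that(3) by linarith
      ultimately have "I = {}" by simp
      then show ?thesis by (simp add: T_def L_def)
    qed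
    then show "\<forall>I\<in>Pow D - ((\<lambda>i. {i}) ` D \<union> {I. I \<subseteq> D \<and> 2 \<le> card I}). T I = 0" by auto
  qed (use D in auto)
  also have "\<dots> = (\<Sum>I\<in>(\<lambda>i. {i}) ` D. T I) + (\<Sum>I\<in>{I. I \<subseteq> D \<and> 2 \<le> card I}. T I)"
    by (rule sum.union_disjoint) (use D in auto)
  also have "(\<Sum>I\<in>(\<lambda>i. {i}) ` D. T I) = (\<Sum>i\<in>D. T {i})"
    by (subst sum.reindex) auto
  finally have "exp (L D) = exp (\<Sum>i\<in>D. T {i}) * exp (\<Sum>I\<in>{I. I \<subseteq> D \<and> 2 \<le> card I}. T I)"
    by (simp add: exp_add)
  moreover have "exp (L D) = g D" using D g[of D] by (simp add: L_def)
  moreover have "(\<Prod>I\<in>{I. I \<subseteq> D \<and> 2 \<le> card I}. \<Prod>J\<in>{J. J \<subseteq> I \<and> J \<noteq> {}}. g J powr ((- 1) ^ card (I - J)))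
      = exp (\<Sum>I\<in>{I. I \<subseteq> D \<and> 2 \<le> card I}. T I)"
    using finP by (simp add: exp_sum T_exp)
  ultimately show ?thesis by (simp add: ind)
qed

section \<open>The decomposition\<close>

lemma ind_part_eq_class:
  assumes D: "finite D" and c: "c \<in> log_L2_densities (cube_lebesgue D)"
  shows "ind_part D c = bayes_class (cube_lebesgue D) (\<lambda>u. \<Prod>i\<in>D. geo_margin D c {i} u)"
proof -
  interpret Q: prob_space "cube_lebesgue D" by (rule prob_space_cube_lebesgue)
  show ?thesis
    unfolding ind_part_def geo_margin_class_def
    by (intro bayes2_finsum_class Q.finite_measure_axioms D geo_margin_in_log_L2 c) auto
qed

lemma int_part_eq_class:
  assumes D: "finite D" and c: "c \<in> log_L2_densities (cube_lebesgue D)" and I: "I \<subseteq> D"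
  shows "int_part D c I = bayes_class (cube_lebesgue D)
    (\<lambda>u. \<Prod>J\<in>{J. J \<subseteq> I \<and> J \<noteq> {}}. geo_margin D c J u powr ((- 1) ^ card (I - J)))"
proof -
  let ?Q = "cube_lebesgue D"
  interpret Q: prob_space ?Q by (rule prob_space_cube_lebesgue)
  interpret B: abelian_group "bayes2 ?Q" by (rule abelian_group_bayes2[OF Q.finite_measure_axioms])
  have fin: "finite {J. J \<subseteq> I \<and> J \<noteq> {}}" using finite_subset[OF I D] by auto
  have geo: "geo_margin D c J \<in> log_L2_densities ?Q" if "J \<subseteq> I" for J
    using that I by (intro geo_margin_in_log_L2[OF D _ c]) auto
  have "int_part D c I = (\<Oplus>\<^bsub>bayes2 ?Q\<^esub>J\<in>{J. J \<subseteq> I \<and> J \<noteq> {}}.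
      bayes_class ?Q (\<lambda>u. geo_margin D c J u powr ((- 1) ^ card (I - J))))"
    unfolding int_part_def geo_margin_class_def
    by (rule B.finsum_cong')
       (auto simp: bayes2_smult_class[OF Q.finite_measure_axioms geo]
             intro!: bayes_class_in_carrier Q.finite_measure_axioms log_L2_densities_powr geo)
  also have "\<dots> = bayes_class ?Q
    (\<lambda>u. \<Prod>J\<in>{J. J \<subseteq> I \<and> J \<noteq> {}}. geo_margin D c J u powr ((- 1) ^ card (I - J)))"
    by (intro bayes2_finsum_class Q.finite_measure_axioms fin log_L2_densities_powr geo) auto
  finally show ?thesis .
qed

text \<open>The decomposition along any measure preserving map into the cube.  Written out in representatives,
  both sides are classes of functions on the cube composed with that map, and the functions agree
  Lebesgue-almost everywhere by \<open>prod_interactions\<close>.\<close>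

lemma bayes_decomposition_comp:
  assumes D: "finite D" "D \<noteq> {}" and c: "c \<in> log_L2_densities (cube_lebesgue D)"
    and P: "finite_measure P"
    and F: "F \<in> measurable P (cube_lebesgue D)" "distr P (cube_lebesgue D) F = cube_lebesgue D"
  shows "bayes_class P (\<lambda>x. c (F x)) \<in> carrier (bayes2 P)"
    and "bayes_comp P (ind_part D c) F \<in> carrier (bayes2 P)"
    and "\<And>I. I \<subseteq> D \<Longrightarrow> bayes_comp P (int_part D c I) F \<in> carrier (bayes2 P)"
    and "bayes_class P (\<lambda>x. c (F x)) =
           bayes_comp P (ind_part D c) F \<oplus>\<^bsub>bayes2 P\<^esub>
           (\<Oplus>\<^bsub>bayes2 P\<^esub>I\<in>{I. I \<subseteq> D \<and> 2 \<le> card I}. bayes_comp P (int_part D c I) F)"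
proof -
  let ?Q = "cube_lebesgue D" and ?S = "{I. I \<subseteq> D \<and> 2 \<le> card I}"
  let ?g = "geo_margin D c"
  interpret Q: prob_space ?Q by (rule prob_space_cube_lebesgue)
  interpret B: abelian_group "bayes2 P" by (rule abelian_group_bayes2[OF P])
  note Qf = Q.finite_measure_axioms
  define a where "a u = (\<Prod>i\<in>D. ?g {i} u)" for u
  define b where "b I u = (\<Prod>J\<in>{J. J \<subseteq> I \<and> J \<noteq> {}}. ?g J u powr ((- 1) ^ card (I - J)))" for I u
  have geo: "?g J \<in> log_L2_densities ?Q" if "J \<subseteq> D" for J
    by (rule geo_margin_in_log_L2[OF D(1) that c])
  have a: "a \<in> log_L2_densities ?Q"
    unfolding a_def by (intro log_L2_densities_prod D geo) auto
  have b: "b I \<in> log_L2_densities ?Q" if "I \<subseteq> D" for I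
    unfolding b_def using that finite_subset[OF that D(1)]
    by (intro log_L2_densities_prod log_L2_densities_powr geo) auto
  have ind: "bayes_comp P (ind_part D c) F = bayes_class P (\<lambda>x. a (F x))"
    using bayes_comp_class[OF P Qf F a] ind_part_eq_class[OF D(1) c] by (simp add: a_def[abs_def])
  have int: "bayes_comp P (int_part D c I) F = bayes_class P (\<lambda>x. b I (F x))" if "I \<subseteq> D" for I
    using bayes_comp_class[OF P Qf F b[OF that]] int_part_eq_class[OF D(1) c that]
    by (simp add: b_def[abs_def])
  note comp = log_L2_densities_comp[OF F]
  have S: "finite ?S" using D by auto
  show "bayes_class P (\<lambda>x. c (F x)) \<in> carrier (bayes2 P)"
    by (rule bayes_class_in_carrier[OF P comp[OF c]])
  show "bayes_comp P (ind_part D c) F \<in> carrier (bayes2 P)"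
    unfolding ind by (rule bayes_class_in_carrier[OF P comp[OF a]])
  show "bayes_comp P (int_part D c I) F \<in> carrier (bayes2 P)" if "I \<subseteq> D" for I
    unfolding int[OF that] by (rule bayes_class_in_carrier[OF P comp[OF b[OF that]]])
  have "AE u in ?Q. \<forall>J\<in>Pow D. 0 < ?g J u"
    using D geo by (intro AE_finite_allI) (auto simp: log_L2_densities_def)
  then have "AE u in ?Q. c u = a u * (\<Prod>I\<in>?S. b I u)"
  proof eventually_elim
    case (elim u)
    have "?g D u = a u * (\<Prod>I\<in>?S. b I u)"
      unfolding a_def b_def by (rule prod_interactions[OF D, symmetric]) (use elim in auto)
    then show ?case by (simp add: geo_margin_def)
  qed
  then have "AE u in distr P ?Q F. c u = a u * (\<Prod>I\<in>?S. b I u)" unfolding F(2) .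
  then have ae: "AE x in P. c (F x) = a (F x) * (\<Prod>I\<in>?S. b I (F x))"
    by (rule AE_distrD[OF F(1)])
  have prod: "(\<lambda>x. \<Prod>I\<in>?S. b I (F x)) \<in> log_L2_densities P"
    by (intro log_L2_densities_prod S comp b) auto
  have "(\<Oplus>\<^bsub>bayes2 P\<^esub>I\<in>?S. bayes_comp P (int_part D c I) F) =
      (\<Oplus>\<^bsub>bayes2 P\<^esub>I\<in>?S. bayes_class P (\<lambda>x. b I (F x)))"
    by (rule B.finsum_cong') (auto simp: int intro!: bayes_class_in_carrier P comp b)
  also have "\<dots> = bayes_class P (\<lambda>x. \<Prod>I\<in>?S. b I (F x))"
    by (intro bayes2_finsum_class P S comp b) auto
  finally have "bayes_comp P (ind_part D c) F \<oplus>\<^bsub>bayes2 P\<^esub>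
      (\<Oplus>\<^bsub>bayes2 P\<^esub>I\<in>?S. bayes_comp P (int_part D c I) F) =
      bayes_class P (\<lambda>x. a (F x) * (\<Prod>I\<in>?S. b I (F x)))"
    by (simp add: ind bayes2_add_class[OF P comp[OF a] prod])
  also have "\<dots> = bayes_class P (\<lambda>x. c (F x))"
    using ae by (intro bayes_class_cong_AE P log_L2_densities_mult comp a c prod) auto
  finally show "bayes_class P (\<lambda>x. c (F x)) = bayes_comp P (ind_part D c) F \<oplus>\<^bsub>bayes2 P\<^esub>
      (\<Oplus>\<^bsub>bayes2 P\<^esub>I\<in>?S. bayes_comp P (int_part D c I) F)" by simp
qed

theorem proposition5p1:
  fixes d :: nat and D :: "nat set"
    and M :: "'a measure" and X :: "nat \<Rightarrow> 'a \<Rightarrow> real"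
    and f :: "nat \<Rightarrow> real \<Rightarrow> real" and \<Omega> :: "nat \<Rightarrow> real set"
    and C c :: "(nat \<Rightarrow> real) \<Rightarrow> real" and P :: "(nat \<Rightarrow> real) measure"
    and F :: "(nat \<Rightarrow> real) \<Rightarrow> (nat \<Rightarrow> real)"
  assumes "2 \<le> d" and D: "D = {1..d}"
    and "prob_space M" and "\<And>i. i \<in> D \<Longrightarrow> X i \<in> borel_measurable M"
    and "is_support (joint_law M D X) (Pi\<^sub>E D \<Omega>)"
    and "absolutely_continuous (\<Pi>\<^sub>M i\<in>D. lborel) (joint_law M D X)"
    and "\<And>i. i \<in> D \<Longrightarrow> distributed M lborel (X i) (\<lambda>t. ennreal (f i t))"
    and "\<And>i t. i \<in> D \<Longrightarrow> t \<in> \<Omega> i \<Longrightarrow> 0 < f i t"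
    and "is_copula_of C M D X" and "is_copula_density D C c"
    and "AE u in cube_lebesgue D. 0 < c u"
    and "integrable (cube_lebesgue D) (\<lambda>u. (ln (c u))\<^sup>2)"
    and P: "P = restrict_space (indep_law M D X) (Pi\<^sub>E D \<Omega>)"
    and F: "F = marginal_cdfs M D X"
  shows "bayes_class P (\<lambda>x. c (F x)) \<in> carrier (bayes2 P) \<and>
         bayes_comp P (ind_part D c) F \<in> carrier (bayes2 P) \<and>
         (\<forall>I. I \<subseteq> D \<and> 2 \<le> card I \<longrightarrow>
            bayes_comp P (int_part D c I) F \<in> carrier (bayes2 P)) \<and>
         bayes_class P (\<lambda>x. c (F x)) =
           bayes_comp P (ind_part D c) F \<oplus>\<^bsub>bayes2 P\<^esub>
           (\<Oplus>\<^bsub>bayes2 P\<^esub>I\<in>{I. I \<subseteq> D \<and> 2 \<le> card I}. bayes_comp P (int_part D c I) F)"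
proof -
  have fin: "finite D" and ne: "D \<noteq> {}" using assms(1) by (auto simp: D)
  note S = indep_law_support[OF fin assms(3) assms(4) assms(5)]
  note F_L = marginal_cdfs_measure_preserving[where X = X, OF fin assms(3) assms(7), folded F]
  have P_prob: "prob_space P"
    unfolding P by (rule prob_space_restrict_space_AE[OF S])
  have F_meas: "F \<in> measurable P (cube_lebesgue D)"
    unfolding P by (rule measurable_restrict_space1[OF F_L(1)])
  have F_distr: "distr P (cube_lebesgue D) F = cube_lebesgue D"
    unfolding P using distr_restrict_space_AE[OF S(2,3) F_L(1)] F_L(2) by simp
  have c: "c \<in> log_L2_densities (cube_lebesgue D)"
    using assms(10-12) by (simp add: log_L2_densities_def is_copula_density_def)
  have P_fin: "finite_measure P" using P_prob by (simp add: prob_space_def)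
  show ?thesis
    using bayes_decomposition_comp[OF fin ne c P_fin F_meas F_distr] by blast
qed

end
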